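(* Let $\gamma\in\mathbb{C}\setminus\{0\}$, $0\leq\lambda\leq 1$, $-1\leq B<A\leq 1$, $m\in\mathbb{N}\setminus\{1\}$, $\mu\in\mathbb{R}\setminus(-\infty,-1]$, $n\in\mathbb{N}\setminus\{1\}$, and let $f(z)=z+\sum_{j=2}^{\infty}a_jz^j$ belong to $\mathcal{K}(\lambda,\gamma,A,B,m,\mu)$. For $k\in\mathbb{N}$ define $A_k=|\gamma(A-B)-B(k-1)|-(k-1)$. (i) If $A_2\leq 0$, then $$|a_n|\leq\frac{|\gamma|(A-B)}{(n-1)(1+(n-1)\lambda)}\cdot\frac{\prod_{j=0}^{m-1}(\mu+j+1)}{\prod_{j=0}^{m-1}(\mu+j+n)}.$$ (ii) If $A_{n-1}\geq 0$, then $$|a_n|\leq\frac{\prod_{j=0}^{n-2}|\gamma(A-B)-jB|}{(n-1)!\,(1+\lambda(n-1))}\cdot\frac{\prod_{j=0}^{m-1}(\mu+j+1)}{\prod_{j=0}^{m-1}(\mu+j+n)}.$$ (iii) If $A_k\geq 0$ and $A_{k+1}\leq 0$ for some $k\in\{2,3,\ldots,n-2\}$, then $$|a_n|\leq\frac{\prod_{j=0}^{k-1}|\gamma(A-B)-jB|}{(n-1)(k-1)!\,(1+\lambda(n-1))}\cdot\frac{\prod_{j=0}^{m-1}(\mu+j+1)}{\prod_{j=0}^{m-1}(\mu+j+n)}.$$ The estimates in (i) and (ii) are sharp.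
   Context: Let $\mathbb{D}=\{z\in\mathbb{C}:|z|<1\}$ and let $\mathcal{A}$ be the family of analytic functions $f$ in $\mathbb{D}$ with $f(0)=0$, $f'(0)=1$. For analytic functions $f,g$ in $\mathbb{D}$, $f\prec g$ ($f$ is subordinate to $g$) means that there is an analytic $\omega:\mathbb{D}\to\mathbb{D}$ with $\omega(0)=0$ and $f(z)=g(\omega(z))$ for $z\in\mathbb{D}$. For $\gamma\in\mathbb{C}\setminus\{0\}$, $0\leq\lambda\leq1$, $-1\leq B<A\leq1$, the class $\mathcal{S}(\lambda,\gamma,A,B)$ consists of all $f\in\mathcal{A}$ such that $$1+\frac{1}{\gamma}\left(\frac{z(\lambda zf'(z)+(1-\lambda)f(z))'}{\lambda zf'(z)+(1-\lambda)f(z)}-1\right)\prec\frac{1+Az}{1+Bz},\quad z\in\mathbb{D}.$$ For $m\in\mathbb{N}\setminus\{1\}$ and $\mu\in\mathbb{R}\setminus(-\infty,-1]$, the class $\mathcal{K}(\lambda,\gamma,A,B,m,\mu)$ consists of all $w=f(z)\in\mathcal{A}$ for which there is $g\in\mathcal{S}(\lambda,\gamma,A,B)$ such that the non-homogeneous Cauchy-Euler type differential equation of order $m$ $$z^m\frac{d^mw}{dz^m}+\binom{m}{1}(\mu+m-1)z^{m-1}\frac{d^{m-1}w}{dz^{m-1}}+\cdots+\binom{m}{m}\prod_{j=0}^{m-1}(\mu+j)\,w=g(z)\prod_{j=0}^{m-1}(\mu+j+1)$$ holds in $\mathbb{D}$; here the general term on the left is $\binom{m}{k}\left(\prod_{j=m-k}^{m-1}(\mu+j)\right)z^{m-k}\frac{d^{m-k}w}{dz^{m-k}}$,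 $k=0,1,\ldots,m$. "Sharp" means that for all parameters and $n$ satisfying the hypothesis of the given part there is a function in the class for which equality holds in the estimate of $|a_n|$. *)

theory Defs
  imports "HOL-Complex_Analysis.Complex_Analysis"
begin

abbreviation unit_disc :: "complex set" where
  "unit_disc \<equiv> ball 0 1"

text \<open>Functions on the disc are total functions on \<open>complex\<close>; their values off the disc are irrelevant.\<close>

definition class_A :: "(complex \<Rightarrow> complex) set" where
  "class_A = {f. f holomorphic_on unit_disc \<and> f 0 = 0 \<and> deriv f 0 = 1}"

definition subordinate :: "(complex \<Rightarrow> complex) \<Rightarrow> (complex \<Rightarrow> complex) \<Rightarrow> bool" where
  "subordinate f g \<longleftrightarrow>
     f holomorphic_on unit_disc \<and> g holomorphic_on unit_disc \<and>
     (\<exists>\<omega>. \<omega> holomorphic_on unit_disc \<and> \<omega> ` unit_disc \<subseteq> unit_disc \<and> \<omega> 0 = 0 \<and>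
          (\<forall>z\<in>unit_disc. f z = g (\<omega> z)))"

text \<open>The convex combination \<open>\<lambda> z f'(z) + (1 - \<lambda>) f(z)\<close>, with \<open>l\<close> standing for \<open>\<lambda>\<close>.\<close>

definition mix :: "real \<Rightarrow> (complex \<Rightarrow> complex) \<Rightarrow> complex \<Rightarrow> complex" where
  "mix l f z = of_real l * z * deriv f z + (1 - of_real l) * f z"

text \<open>
  The quotient \<open>z F'(z) / F(z)\<close>. For \<open>F\<close> in \<open>class_A\<close> it has a removable singularity at \<open>0\<close>
  with value \<open>1\<close>, which has to be filled in because HOL division gives \<open>0 / 0 = 0\<close>.
\<close>

definition log_deriv_quot :: "(complex \<Rightarrow> complex) \<Rightarrow> complex \<Rightarrow> complex" where
  "log_deriv_quot F z = (if z = 0 then 1 else z * deriv F z / F z)"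

text \<open>
  The condition that \<open>mix l f\<close> has no zero except \<open>0\<close> is implicit in the subordination (a zero
  would be a pole of the quotient); it is made explicit because HOL division is total.
\<close>

definition class_S :: "real \<Rightarrow> complex \<Rightarrow> real \<Rightarrow> real \<Rightarrow> (complex \<Rightarrow> complex) set" where
  "class_S l \<gamma> A B =
     {f \<in> class_A.
        (\<forall>z\<in>unit_disc - {0}. mix l f z \<noteq> 0) \<and>
        subordinate
          (\<lambda>z. 1 + 1 / \<gamma> * (log_deriv_quot (mix l f) z - 1))
          (\<lambda>z. (1 + of_real A * z) / (1 + of_real B * z))}"

definition class_K ::
  "real \<Rightarrow> complex \<Rightarrow> real \<Rightarrow> real \<Rightarrow> nat \<Rightarrow> real \<Rightarrow> (complex \<Rightarrow> complex) set" where
  "class_K l \<gamma> A B m \<mu> =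
     {f \<in> class_A. \<exists>g \<in> class_S l \<gamma> A B. \<forall>z\<in>unit_disc.
        (\<Sum>k=0..m. of_nat (m choose k) * of_real (\<Prod>j=m-k..<m. \<mu> + real j)
                    * z ^ (m - k) * (deriv ^^ (m - k)) f z)
        = g z * of_real (\<Prod>j=0..<m. \<mu> + real j + 1)}"

text \<open>\<open>f(z) = z + \<Sum>j\<ge>2. a\<^sub>j z^j\<close> on the disc; \<open>a 0\<close> and \<open>a 1\<close> play no role.\<close>

definition has_expansion :: "(complex \<Rightarrow> complex) \<Rightarrow> (nat \<Rightarrow> complex) \<Rightarrow> bool" where
  "has_expansion f a \<longleftrightarrow>
     (\<forall>z\<in>unit_disc. (\<lambda>j. a (j + 2) * z ^ (j + 2)) sums (f z - z))"

definition Acoef :: "complex \<Rightarrow> real \<Rightarrow> real \<Rightarrow> nat \<Rightarrow> real" where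
  "Acoef \<gamma> A B k =
     cmod (\<gamma> * of_real (A - B) - of_real (B * (real k - 1))) - (real k - 1)"

end

theory Submission
  imports Defs
begin

text \<open>
  Both operators in the definition of the class act diagonally on Taylor coefficients: \<open>mix l\<close>
  multiplies the \<open>k\<close>-th coefficient by \<open>1 + (k - 1) l\<close>, and the Cauchy-Euler operator multiplies it
  by \<open>(\<mu> + k) \<dots> (\<mu> + k + m - 1)\<close>, a form of the Vandermonde identity
  (\<open>pochhammer_binomial_falling\<close>). Everything thus reduces to the coefficients \<open>c\<^sub>k\<close> of
  \<open>F = mix l g\<close>, where \<open>g\<close> belongs to the class S.

  The subordination supplies a function \<open>\<omega>\<close> with \<open>\<omega>(0) = 0\<close>, \<open>\<bar>\<omega>\<bar> < 1\<close> and
  \<open>z F' - F = \<omega> (\<gamma> (A - B) F - B (z F' - F))\<close>. Multiplication by \<open>\<omega>\<close> raises the order at the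
  origin and does not increase mean squares on circles, so Clunie's method
  (\<open>clunie_inequality\<close>) yields, with \<open>\<alpha>\<^sub>i = \<bar>\<gamma> (A - B) - i B\<bar>\<close>,
  \<open>j\<^sup>2 \<bar>c\<^sub>j\<^sub>+\<^sub>1\<bar>\<^sup>2 \<le> (\<Sum>i<j. (\<alpha>\<^sub>i\<^sup>2 - i\<^sup>2) \<bar>c\<^sub>i\<^sub>+\<^sub>1\<bar>\<^sup>2)\<close>.
  The number \<open>Acoef \<gamma> A B (i + 1)\<close> is \<open>\<alpha>\<^sub>i - i\<close>, and it is nonincreasing in \<open>i\<close>
  (\<open>Acoef_antimono\<close>). The weights are therefore nonnegative up to some index and nonpositive
  afterwards; estimating \<open>\<bar>c\<^sub>i\<^sub>+\<^sub>1\<bar>\<close> by induction where the weight is nonnegative, and dropping the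
  term where it is not, gives all three bounds at once (\<open>recursive_square_bound\<close>).

  For sharpness the choice \<open>\<omega>(z) = z^p\<close> leads to an explicit equation for \<open>F\<close> whose coefficients
  satisfy a two-term recursion: \<open>p = n - 1\<close> attains the first bound and \<open>p = 1\<close> the second. The diagonal
  operators are then inverted coefficientwise, which keeps the radius of convergence because the
  multipliers are bounded.
\<close>

section \<open>Power series on the unit disc\<close>

text \<open>
  A relation between a function and its Taylor coefficients, rather than a coefficient
  functional: linear combinations, shifts and the Euler operators then act on the second
  argument by plain formulas, and all differential equations below become identities
  between coefficients.
\<close>
definition disc_series :: "(complex \<Rightarrow> complex) \<Rightarrow> (nat \<Rightarrow> complex) \<Rightarrow> bool" where
  "disc_series f c \<longleftrightarrow> (\<forall>z\<in>unit_disc. (\<lambda>k. c k * z ^ k) sums f z)"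

lemma disc_seriesD: "disc_series f c \<Longrightarrow> z \<in> unit_disc \<Longrightarrow> (\<lambda>k. c k * z ^ k) sums f z"
  by (simp add: disc_series_def)

lemma disc_series_holomorphic: "disc_series f c \<Longrightarrow> f holomorphic_on unit_disc"
  by (rule power_series_holomorphic[of _ _ c]) (auto dest: disc_seriesD)

lemma holomorphic_disc_series:
  assumes "f holomorphic_on unit_disc"
  shows "disc_series f (\<lambda>k. (deriv ^^ k) f 0 / fact k)"
  using holomorphic_power_series[OF assms] by (auto simp: disc_series_def)

lemma disc_series_coeff:
  assumes "disc_series f c"
  shows "c k = (deriv ^^ k) f 0 / fact k"
proof -
  have "eventually (\<lambda>z. z \<in> unit_disc) (nhds (0::complex))"
    by (intro eventually_nhds_in_open) auto
  hence "f has_fps_expansion Abs_fps c"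
    by (intro has_fps_expansionI, elim eventually_mono) (use assms in \<open>auto dest: disc_seriesD\<close>)
  from fps_nth_fps_expansion[OF this, of k] show ?thesis by simp
qed

lemma disc_series_unique:
  assumes "disc_series f c" "disc_series g d" "\<And>z. z \<in> unit_disc \<Longrightarrow> f z = g z"
  shows "c k = d k"
proof -
  have "disc_series f d" using assms(2,3) by (simp add: disc_series_def)
  then show ?thesis using assms(1) disc_series_coeff by metis
qed

lemma disc_series_eq:
  assumes "disc_series f c" "disc_series g c" "z \<in> unit_disc"
  shows "f z = g z"
  using assms by (meson disc_seriesD sums_unique2)

lemma disc_series_at_0: "disc_series f c \<Longrightarrow> c 0 = f 0"
  using disc_series_coeff[of f c 0] by simp

lemma disc_series_deriv_at_0: "disc_series f c \<Longrightarrow> c 1 = deriv f 0"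
  using disc_series_coeff[of f c 1] by simp

lemma disc_series_add: "disc_series f c \<Longrightarrow> disc_series g d \<Longrightarrow> disc_series (\<lambda>z. f z + g z) (\<lambda>k. c k + d k)"
  by (simp add: disc_series_def ring_distribs sums_add)

lemma disc_series_diff: "disc_series f c \<Longrightarrow> disc_series g d \<Longrightarrow> disc_series (\<lambda>z. f z - g z) (\<lambda>k. c k - d k)"
  by (simp add: disc_series_def ring_distribs sums_diff)

lemma disc_series_cmult: "disc_series f c \<Longrightarrow> disc_series (\<lambda>z. a * f z) (\<lambda>k. a * c k)"
  by (simp add: disc_series_def mult.assoc sums_mult)

lemma disc_series_sum:
  "(\<And>i. i \<in> I \<Longrightarrow> disc_series (f i) (c i)) \<Longrightarrow>
    disc_series (\<lambda>z. \<Sum>i\<in>I. f i z) (\<lambda>k. \<Sum>i\<in>I. c i k)"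
  by (simp add: disc_series_def sum_distrib_right sums_sum)

lemma disc_series_power_mult:
  assumes "disc_series f c"
  shows "disc_series (\<lambda>z. z ^ p * f z) (\<lambda>k. if k < p then 0 else c (k - p))"
  unfolding disc_series_def
proof
  fix z :: complex assume z: "z \<in> unit_disc"
  let ?u = "\<lambda>k. (if k < p then 0 else c (k - p)) * z ^ k"
  have "(\<lambda>k. ?u (k + p)) sums (z ^ p * f z)"
    using sums_mult[OF disc_seriesD[OF assms z], of "z ^ p"] by (simp add: power_add mult_ac)
  then have "?u sums (z ^ p * f z + (\<Sum>k<p. ?u k))" by (subst (asm) sums_iff_shift) simp
  then show "?u sums (z ^ p * f z)" by simp
qed

text \<open>
  The operator \<open>z^j d^j/dz^j\<close> multiplies the \<open>k\<close>-th coefficient by the falling factorial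
  \<open>k (k - 1) \<dots> (k - j + 1)\<close>, written as a rising factorial in the complex numbers; it vanishes
  by itself for \<open>k < j\<close>, so that no case distinction survives.
\<close>
lemma disc_series_deriv_power:
  assumes "disc_series f c"
  shows "disc_series (\<lambda>z. z ^ j * (deriv ^^ j) f z) (\<lambda>k. pochhammer (of_nat k - of_nat j + 1) j * c k)"
proof -
  have "disc_series ((deriv ^^ j) f) (\<lambda>k. pochhammer (of_nat k + 1) j * c (k + j))"
  proof -
    have "(deriv ^^ j) f holomorphic_on unit_disc"
      by (intro holomorphic_higher_deriv disc_series_holomorphic[OF assms]) auto
    from holomorphic_disc_series[OF this]
    have "disc_series ((deriv ^^ j) f) (\<lambda>k. (deriv ^^ (k + j)) f 0 / fact k)"
      by (simp add: funpow_add)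
    moreover have "(deriv ^^ (k + j)) f 0 / fact k = pochhammer (of_nat k + 1) j * c (k + j)" for k
    proof -
      have "fact (k + j) = (fact k * pochhammer (of_nat k + 1) j :: complex)"
        using pochhammer_product'[of "1 :: complex" k j] by (simp add: pochhammer_fact add.commute)
      moreover have "(deriv ^^ (k + j)) f 0 = fact (k + j) * c (k + j)"
        by (simp add: disc_series_coeff[OF assms])
      ultimately show ?thesis by simp
    qed
    ultimately show ?thesis by simp
  qed
  from disc_series_power_mult[OF this, of j]
  have "disc_series (\<lambda>z. z ^ j * (deriv ^^ j) f z)
      (\<lambda>k. if k < j then 0 else pochhammer (of_nat (k - j) + 1) j * c (k - j + j))" .
  moreover have "(if k < j then 0 else pochhammer (of_nat (k - j) + 1) j * c (k - j + j))
      = pochhammer (of_nat k - of_nat j + 1) j * c k" for k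
  proof (cases "k < j")
    case True
    then have "of_nat k - of_nat j + 1 = - (of_nat (j - k - 1) :: complex)" by (simp add: of_nat_diff)
    moreover have "pochhammer (- of_nat (j - k - 1) :: complex) j = 0"
      using True by (subst pochhammer_eq_0_iff) (auto intro!: exI[of _ "j - k - 1"])
    ultimately have "pochhammer (of_nat k - of_nat j + 1 :: complex) j = 0" by (simp only:)
    then show ?thesis using True by simp
  qed (simp add: of_nat_diff)
  ultimately show ?thesis by simp
qed

lemma disc_series_times_deriv:
  assumes "disc_series f c"
  shows "disc_series (\<lambda>z. z * deriv f z) (\<lambda>k. of_nat k * c k)"
  using disc_series_deriv_power[OF assms, of 1] by simp

text \<open>
  Bounded multipliers do not shrink the radius of convergence. The operator \<^const>\<open>mix\<close>
  and the Cauchy-Euler operator are inverted in this way when extremal functions are constructed.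
\<close>
lemma disc_series_multiplier:
  assumes "disc_series f c" "\<And>k. cmod (d k) \<le> 1"
  obtains g where "disc_series g (\<lambda>k. d k * c k)"
proof
  show "disc_series (\<lambda>z. \<Sum>k. d k * c k * z ^ k) (\<lambda>k. d k * c k)"
    unfolding disc_series_def
  proof
    fix z :: complex assume z: "z \<in> unit_disc"
    define r where "r = (1 + cmod z) / 2"
    have r: "cmod z < r" "r < 1" using z by (auto simp: r_def field_simps)
    then have "0 \<le> r" using norm_ge_zero[of z] by linarith
    then have "summable (\<lambda>k. norm (c k * z ^ k))"
      using r disc_seriesD[OF assms(1), of "of_real r"]
      by (intro powser_insidea[of c "of_real r"]) (auto simp: sums_iff)
    then have "summable (\<lambda>k. d k * c k * z ^ k)"
    proof (rule summable_comparison_test')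
      fix k
      show "norm (d k * c k * z ^ k) \<le> norm (c k * z ^ k)"
        using mult_right_mono[OF assms(2)[of k], of "norm (c k * z ^ k)"]
        by (simp add: norm_mult mult.assoc)
    qed
    then show "(\<lambda>k. d k * c k * z ^ k) sums (\<Sum>k. d k * c k * z ^ k)" by (rule summable_sums)
  qed
qed

lemma disc_series_remainder:
  assumes "disc_series f c"
  obtains q where "q holomorphic_on unit_disc"
    "\<And>z. z \<in> unit_disc \<Longrightarrow> f z = (\<Sum>k<n. c k * z ^ k) + z ^ n * q z"
proof -
  define q where "q = (\<lambda>z. \<Sum>k. c (k + n) * z ^ k)"
  have q: "(\<lambda>k. c (k + n) * z ^ k) sums q z \<and> f z = (\<Sum>k<n. c k * z ^ k) + z ^ n * q z"
    if z: "z \<in> unit_disc" for z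
  proof (cases "z = 0")
    case True
    have "(\<lambda>k. c (k + n) * 0 ^ k) sums c (0 + n)" by (rule powser_sums_zero)
    moreover have "c 0 = f 0" by (rule disc_series_at_0[OF assms])
    ultimately show ?thesis using True
      by (auto simp: q_def sums_iff power_0_left if_distrib sum.delta cong: if_cong)
  next
    case False
    have "(\<lambda>k. c (k + n) * z ^ (k + n)) sums (f z - (\<Sum>k<n. c k * z ^ k))"
      using disc_seriesD[OF assms z] by (subst sums_iff_shift) simp
    from sums_mult[OF this, of "1 / z ^ n"] False
    have *: "(\<lambda>k. c (k + n) * z ^ k) sums ((f z - (\<Sum>k<n. c k * z ^ k)) / z ^ n)"
      by (simp add: power_add)
    then have "q z = (f z - (\<Sum>k<n. c k * z ^ k)) / z ^ n" by (simp add: q_def sums_iff)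
    with * False show ?thesis by simp
  qed
  show thesis
    by (rule that[of q], rule disc_series_holomorphic[of q "\<lambda>k. c (k + n)"])
      (use q in \<open>auto simp: disc_series_def\<close>)
qed

section \<open>Mean squares on circles and the Clunie inequality\<close>

text \<open>
  This is Cauchy's integral formula at the centre of the circle.
\<close>
lemma circle_mean_value:
  assumes "h holomorphic_on unit_disc" "0 < r" "r < 1"
  shows "((\<lambda>t. h (circlepath 0 r t)) has_integral h 0) {0..1}"
proof -
  have "h holomorphic_on cball 0 r"
    using assms by (intro holomorphic_on_subset[OF assms(1)]) auto
  then have "((\<lambda>u. h u / (u - 0)) has_contour_integral (2 * of_real pi * \<i> * h 0)) (circlepath 0 r)"
    using assms by (intro Cauchy_integral_circlepath_simple) auto
  then have "((\<lambda>t. h (circlepath 0 r t) / circlepath 0 r t * vector_derivative (circlepath 0 r) (at t within {0..1}))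
     has_integral (2 * of_real pi * \<i> * h 0)) {0..1}"
    by (simp add: has_contour_integral_def)
  then have "((\<lambda>t. 2 * of_real pi * \<i> * h (circlepath 0 r t)) has_integral (2 * of_real pi * \<i> * h 0)) {0..1}"
    by (rule has_integral_eq[rotated])
      (use assms in \<open>simp add: vector_derivative_circlepath01, simp add: circlepath\<close>)
  from has_integral_mult_right[OF this, of "1 / (2 * of_real pi * \<i>)"] show ?thesis by simp
qed

definition mean_square :: "real \<Rightarrow> (complex \<Rightarrow> complex) \<Rightarrow> real" where
  "mean_square r h = integral {0..1} (\<lambda>t. (cmod (h (circlepath 0 r t)))\<^sup>2)"

lemma circlepath_in_disc: "0 < r \<Longrightarrow> r < 1 \<Longrightarrow> circlepath 0 r t \<in> unit_disc"
  and norm_circlepath_0: "0 < r \<Longrightarrow> cmod (circlepath 0 r t) = r"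
  by (auto simp: circlepath norm_mult norm_exp_eq_Re)

lemma mean_square_integrable:
  assumes "h holomorphic_on unit_disc" "0 < r" "r < 1"
  shows "(\<lambda>t. (cmod (h (circlepath 0 r t)))\<^sup>2) integrable_on {0..1}"
proof (rule integrable_continuous_real)
  have "continuous_on {0..1} (\<lambda>t. h (circlepath 0 r t))"
    by (rule continuous_on_compose2[OF holomorphic_on_imp_continuous_on[OF assms(1)]])
      (use assms circlepath_in_disc in \<open>auto simp: circlepath intro!: continuous_intros\<close>)
  then show "continuous_on {0..1} (\<lambda>t. (cmod (h (circlepath 0 r t)))\<^sup>2)"
    by (intro continuous_intros)
qed

lemma mean_square_mono:
  assumes "f holomorphic_on unit_disc" "g holomorphic_on unit_disc" "0 < r" "r < 1"
    and "\<And>z. z \<in> unit_disc \<Longrightarrow> cmod (f z) \<le> cmod (g z)"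
  shows "mean_square r f \<le> mean_square r g"
  unfolding mean_square_def using assms circlepath_in_disc
  by (intro integral_le mean_square_integrable power_mono) auto

text \<open>
  A polynomial of degree less than \<open>n\<close> is orthogonal to every multiple of \<open>z^n\<close>. On the circle
  \<open>cnj z = r\<^sup>2 / z\<close>, so the product of the conjugate polynomial with \<open>z^n q\<close> agrees there with a
  holomorphic function \<open>W\<close> that vanishes at the origin, and the mean value property kills its mean.
  The two facts about Fourier series that are needed, Bessel's inequality for a holomorphic
  function and Parseval's identity for a polynomial, both follow.
\<close>
lemma mean_square_Pythagoras:
  assumes "q holomorphic_on unit_disc" "0 < r" "r < 1"
  shows "mean_square r (\<lambda>z. (\<Sum>k<n. s k * z ^ k) + z ^ n * q z)
       = mean_square r (\<lambda>z. \<Sum>k<n. s k * z ^ k) + mean_square r (\<lambda>z. z ^ n * q z)"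
proof -
  let ?S = "\<lambda>z. \<Sum>k<n. s k * z ^ k" and ?R = "\<lambda>z. z ^ n * q z"
  define W where "W = (\<lambda>z. \<Sum>k<n. cnj (s k) * of_real (r ^ (2 * k)) * z ^ (n - k) * q z)"
  have W: "W holomorphic_on unit_disc"
    unfolding W_def by (intro holomorphic_intros assms)
  have W0: "W 0 = 0" by (auto simp: W_def intro!: sum.neutral)
  have key: "(cmod (?S z + ?R z))\<^sup>2 = (cmod (?S z))\<^sup>2 + (cmod (?R z))\<^sup>2 + 2 * Re (W z)"
    if z: "cmod z = r" for z
  proof -
    have "cnj z ^ k * z ^ n = of_real (r ^ (2 * k)) * z ^ (n - k)" if "k < n" for k
    proof -
      have "cnj z ^ k * z ^ n = (z * cnj z) ^ k * z ^ (n - k)"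
        using that by (simp add: power_mult_distrib mult_ac flip: power_add)
      also have "z * cnj z = of_real (r\<^sup>2)" using z by (metis complex_norm_square of_real_power)
      finally show ?thesis by (simp add: power_mult)
    qed
    then have "cnj (s k) * (cnj z ^ k * z ^ n) * q z = cnj (s k) * (of_real (r ^ (2 * k)) * z ^ (n - k)) * q z"
      if "k < n" for k using that by simp
    then have "cnj (?S z) * ?R z = W z"
      unfolding W_def cnj_sum sum_distrib_right complex_cnj_mult complex_cnj_power
      by (intro sum.cong) (simp_all only: lessThan_iff mult.assoc)
    moreover have "(cmod (?S z + ?R z))\<^sup>2 = (cmod (?S z))\<^sup>2 + (cmod (?R z))\<^sup>2 + 2 * Re (cnj (?S z) * ?R z)"
      unfolding cmod_power2 by (simp only: power2_eq_square plus_complex.sel times_complex.sel cnj.sel) algebra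
    ultimately show ?thesis by simp
  qed
  have "((\<lambda>t. Re (W (circlepath 0 r t))) has_integral Re (W 0)) {0..1}"
    by (intro has_integral_Re circle_mean_value[OF W] assms)
  from has_integral_mult_right[OF this, of 2]
  have "((\<lambda>t. 2 * Re (W (circlepath 0 r t))) has_integral 0) {0..1}"
    by (simp add: W0)
  moreover have "((\<lambda>t. (cmod (?S (circlepath 0 r t)))\<^sup>2) has_integral mean_square r ?S) {0..1}"
    "((\<lambda>t. (cmod (?R (circlepath 0 r t)))\<^sup>2) has_integral mean_square r ?R) {0..1}"
    unfolding mean_square_def
    by (intro integrable_integral mean_square_integrable holomorphic_intros assms)+
  ultimately have "((\<lambda>t. (cmod (?S (circlepath 0 r t)))\<^sup>2 + (cmod (?R (circlepath 0 r t)))\<^sup>2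
      + 2 * Re (W (circlepath 0 r t))) has_integral (mean_square r ?S + mean_square r ?R + 0)) {0..1}"
    by (intro has_integral_add)
  then have "((\<lambda>t. (cmod (?S (circlepath 0 r t) + ?R (circlepath 0 r t)))\<^sup>2)
      has_integral (mean_square r ?S + mean_square r ?R)) {0..1}"
    using key[OF norm_circlepath_0[OF assms(2)]] by simp
  then show ?thesis unfolding mean_square_def[of r "\<lambda>z. ?S z + ?R z"] by (rule integral_unique)
qed

lemma mean_square_polynomial:
  assumes "0 < r" "r < 1"
  shows "mean_square r (\<lambda>z. \<Sum>k<n. s k * z ^ k) = (\<Sum>k<n. (cmod (s k))\<^sup>2 * r ^ (2 * k))"
proof (induction n)
  case (Suc n)
  have "mean_square r (\<lambda>z. z ^ n * s n) = (cmod (s n))\<^sup>2 * r ^ (2 * n)"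
    unfolding mean_square_def using norm_circlepath_0[OF assms(1)]
    by (simp add: norm_mult norm_power power_mult_distrib mult.commute flip: power_mult)
  with Suc mean_square_Pythagoras[of "\<lambda>_. s n", OF _ assms, of s n]
  show ?case by (simp add: mult.commute)
qed (simp add: mean_square_def)

text \<open>
  Truncate \<open>D\<close> to its polynomial \<open>D\<^sub>n\<close> of degree less than \<open>n\<close>. Because \<open>\<omega>\<close> vanishes at the origin,
  the discarded part contributes to \<open>\<omega> D\<close> only from \<open>z^(n+1)\<close> on; so \<open>\<omega> D\<^sub>n\<close> still begins with
  \<open>p\<^sub>0, \<dots>, p\<^sub>n\<close>. By Bessel's inequality its mean square is at least that of this beginning, and
  by \<open>\<bar>\<omega>\<bar> \<le> 1\<close> it is at most that of \<open>D\<^sub>n\<close>. Finally the radius tends to \<open>1\<close>.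
\<close>
lemma clunie_inequality:
  assumes "\<omega> holomorphic_on unit_disc" "\<And>z. z \<in> unit_disc \<Longrightarrow> cmod (\<omega> z) \<le> 1" "\<omega> 0 = 0"
    and P: "disc_series P p" and D: "disc_series D d"
    and PD: "\<And>z. z \<in> unit_disc \<Longrightarrow> P z = \<omega> z * D z"
  shows "(\<Sum>k<Suc n. (cmod (p k))\<^sup>2) \<le> (\<Sum>k<n. (cmod (d k))\<^sup>2)"
proof -
  let ?Dn = "\<lambda>z. \<Sum>k<n. d k * z ^ k" and ?Pn = "\<lambda>z. \<Sum>k<Suc n. p k * z ^ k"
  obtain e where e: "e holomorphic_on unit_disc" "\<And>z. z \<in> unit_disc \<Longrightarrow> D z = ?Dn z + z ^ n * e z"
    using disc_series_remainder[OF D] by blast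
  obtain f where f: "f holomorphic_on unit_disc" "\<And>z. z \<in> unit_disc \<Longrightarrow> P z = ?Pn z + z ^ Suc n * f z"
    using disc_series_remainder[OF P] by blast
  obtain \<phi> where \<phi>: "\<phi> holomorphic_on unit_disc" "\<And>z. z \<in> unit_disc \<Longrightarrow> \<omega> z = z * \<phi> z"
    using disc_series_remainder[OF holomorphic_disc_series[OF assms(1)], of 1] assms(3) by auto
  define q where "q = (\<lambda>z. f z - \<phi> z * e z)"
  have q: "q holomorphic_on unit_disc" unfolding q_def by (intro holomorphic_intros e f \<phi>)
  have split: "\<omega> z * ?Dn z = ?Pn z + z ^ Suc n * q z" if "z \<in> unit_disc" for z
    using e(2)[OF that] f(2)[OF that] \<phi>(2)[OF that] PD[OF that]
    by (simp add: q_def algebra_simps)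
  have le: "(\<Sum>k<Suc n. (cmod (p k))\<^sup>2 * r ^ (2 * k)) \<le> (\<Sum>k<n. (cmod (d k))\<^sup>2 * r ^ (2 * k))"
    if r: "0 < r" "r < 1" for r :: real
  proof -
    have "(\<Sum>k<Suc n. (cmod (p k))\<^sup>2 * r ^ (2 * k)) = mean_square r ?Pn"
      by (rule mean_square_polynomial[OF r, symmetric])
    also have "\<dots> \<le> mean_square r ?Pn + mean_square r (\<lambda>z. z ^ Suc n * q z)"
      using integral_nonneg[OF mean_square_integrable[of "\<lambda>z. z ^ Suc n * q z", OF _ r]] q
      by (simp add: mean_square_def holomorphic_intros)
    also have "\<dots> = mean_square r (\<lambda>z. ?Pn z + z ^ Suc n * q z)"
      by (rule mean_square_Pythagoras[OF q r, symmetric])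
    also have "\<dots> \<le> mean_square r ?Dn"
    proof (rule mean_square_mono[OF _ _ r])
      fix z assume z: "z \<in> unit_disc"
      show "cmod (?Pn z + z ^ Suc n * q z) \<le> cmod (?Dn z)"
        using mult_right_mono[OF assms(2)[OF z], of "cmod (?Dn z)"]
        by (simp only: split[OF z, symmetric] norm_mult) simp
    qed (intro holomorphic_intros q)+
    also have "\<dots> = (\<Sum>k<n. (cmod (d k))\<^sup>2 * r ^ (2 * k))"
      by (rule mean_square_polynomial[OF r])
    finally show ?thesis .
  qed
  have lim: "((\<lambda>r. \<Sum>k<N. (cmod (a k))\<^sup>2 * r ^ (2 * k)) \<longlongrightarrow> (\<Sum>k<N. (cmod (a k))\<^sup>2)) (at_left 1)"
    for N and a :: "nat \<Rightarrow> complex"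
    by (rule tendsto_eq_intros refl | simp)+
  have "eventually (\<lambda>r::real. r \<in> {0<..<1}) (at_left 1)"
    by (rule eventually_at_left_real) simp
  then show ?thesis
    by (intro tendsto_le[OF _ lim lim]) (auto elim!: eventually_mono simp del: sum.lessThan_Suc intro: le)
qed

section \<open>Solving the recursive inequality\<close>

text \<open>
  The products \<open>Q j = (\<Prod>i<j. \<alpha> i) / j!\<close> turn the recursive inequality into an equality, since
  \<open>(j + 1) Q (j + 1) = \<alpha> j Q j\<close> makes the sum telescope. As long as the weights \<open>\<alpha> i\<^sup>2 - i\<^sup>2\<close> are
  nonnegative, induction gives \<open>x j \<le> Q j\<close>. From the index \<open>K\<close> on, where the weights are nonpositive,
  the corresponding terms are dropped. Each of the three estimates of the theorem is an instance:
  \<open>K = 1\<close>, \<open>K = j\<close>, and \<open>K\<close> the index at which the weights change sign.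
\<close>
lemma recursive_square_bound:
  fixes \<alpha> x :: "nat \<Rightarrow> real"
  assumes x: "\<And>j. 0 \<le> x j" "x 0 = 1"
    and rec: "\<And>j. (real j * x j)\<^sup>2 \<le> (\<Sum>i<j. ((\<alpha> i)\<^sup>2 - (real i)\<^sup>2) * (x i)\<^sup>2)"
    and K: "1 \<le> K" "K \<le> j" "\<And>i. i < K \<Longrightarrow> real i \<le> \<alpha> i"
    and tail: "\<And>i. K \<le> i \<Longrightarrow> i < j \<Longrightarrow> 0 \<le> \<alpha> i \<and> \<alpha> i \<le> real i"
  shows "real j * x j \<le> (\<Prod>i<K. \<alpha> i) / fact (K - 1)"
proof -
  define Q where "Q = (\<lambda>j. (\<Prod>i<j. \<alpha> i) / fact j)"
  have Q_Suc: "real (Suc i) * Q (Suc i) = \<alpha> i * Q i" for i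
    by (simp add: Q_def field_simps del: of_nat_Suc)
  have tele: "(\<Sum>i<j. ((\<alpha> i)\<^sup>2 - (real i)\<^sup>2) * (Q i)\<^sup>2) = (real j * Q j)\<^sup>2" for j
  proof (induction j)
    case (Suc j)
    then show ?case
      unfolding sum.lessThan_Suc Q_Suc by (simp add: algebra_simps power_mult_distrib)
  qed simp
  have \<alpha>0: "0 \<le> \<alpha> i" if "i < K" for i using K(3)[OF that] by simp
  have Q0: "0 \<le> Q i" if "i \<le> K" for i
    unfolding Q_def using that by (intro divide_nonneg_nonneg prod_nonneg) (auto intro: \<alpha>0)
  have head: "(\<Sum>i<j. ((\<alpha> i)\<^sup>2 - (real i)\<^sup>2) * (x i)\<^sup>2) \<le> (real j * Q j)\<^sup>2"
    if "j \<le> K" "\<And>i. i < j \<Longrightarrow> x i \<le> Q i" for j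
    unfolding tele[symmetric]
  proof (intro sum_mono mult_left_mono power_mono)
    fix i assume "i \<in> {..<j}"
    then have "i < K" "x i \<le> Q i" using that by auto
    then show "x i \<le> Q i" "0 \<le> x i" "0 \<le> (\<alpha> i)\<^sup>2 - (real i)\<^sup>2"
      using K(3)[of i] x by (auto intro: power_mono)
  qed
  have xQ: "x i \<le> Q i" if "i \<le> K" for i
    using that
  proof (induction i rule: less_induct)
    case (less i)
    show ?case
    proof (cases "i = 0")
      case True
      then show ?thesis using x by (simp add: Q_def)
    next
      case False
      have "(real i * x i)\<^sup>2 \<le> (real i * Q i)\<^sup>2"
        by (rule order_trans[OF rec head]) (use less in auto)
      then have "real i * x i \<le> real i * Q i"
        by (rule power2_le_imp_le) (simp add: Q0 less.prems)
      then show ?thesis using False by simp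
    qed
  qed
  have "(real j * x j)\<^sup>2 \<le> (\<Sum>i<j. ((\<alpha> i)\<^sup>2 - (real i)\<^sup>2) * (x i)\<^sup>2)" by (rule rec)
  also have "\<dots> \<le> (\<Sum>i<K. ((\<alpha> i)\<^sup>2 - (real i)\<^sup>2) * (x i)\<^sup>2)"
  proof -
    have "(\<Sum>i<j. ((\<alpha> i)\<^sup>2 - (real i)\<^sup>2) * (x i)\<^sup>2) =
      (\<Sum>i<K. ((\<alpha> i)\<^sup>2 - (real i)\<^sup>2) * (x i)\<^sup>2) + (\<Sum>i=K..<j. ((\<alpha> i)\<^sup>2 - (real i)\<^sup>2) * (x i)\<^sup>2)"
      using K(2) by (simp add: lessThan_atLeast0 sum.atLeastLessThan_concat)
    moreover have "(\<Sum>i=K..<j. ((\<alpha> i)\<^sup>2 - (real i)\<^sup>2) * (x i)\<^sup>2) \<le> 0"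
      using tail by (intro sum_nonpos mult_nonpos_nonneg) (auto intro: power_mono)
    ultimately show ?thesis by linarith
  qed
  also have "\<dots> \<le> (real K * Q K)\<^sup>2" by (rule head) (auto intro: xQ)
  finally have "real j * x j \<le> real K * Q K"
    by (rule power2_le_imp_le) (simp add: Q0)
  also have "\<dots> = (\<Prod>i<K. \<alpha> i) / fact (K - 1)"
    using K(1) by (cases K) (simp_all add: Q_def field_simps del: of_nat_Suc)
  finally show ?thesis .
qed

section \<open>The Cauchy-Euler operator\<close>

text \<open>
  The Vandermonde convolution for falling factorials. It is reduced to the one for rising
  factorials by changing the signs of both arguments.
\<close>
lemma pochhammer_binomial_falling:
  fixes x y :: "'a :: comm_ring_1"
  shows "(\<Sum>k\<le>m. of_nat (m choose k) * (\<Prod>j=m-k..<m. x + of_nat j)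
            * pochhammer (y - of_nat (m - k) + 1) (m - k)) = pochhammer (x + y) m"
proof -
  have "(\<Sum>k\<le>m. of_nat (m choose k) * (\<Prod>j=m-k..<m. x + of_nat j)
            * pochhammer (y - of_nat (m - k) + 1) (m - k))
      = (\<Sum>k\<le>m. (- 1) ^ m * (of_nat (m choose k) * pochhammer (- (x + of_nat m - 1)) k * pochhammer (- y) (m - k)))"
  proof (intro sum.cong refl)
    fix k assume "k \<in> {..m}"
    then have k: "k \<le> m" by simp
    have "(\<Prod>j=m-k..<m. x + of_nat j) = pochhammer (x + of_nat m - of_nat k) k"
      unfolding pochhammer_prod using k
      by (subst prod.atLeastLessThan_shift_0) (auto simp: of_nat_diff algebra_simps intro!: prod.cong)
    moreover have "pochhammer (- (x + of_nat m - 1)) k = (- 1) ^ k * pochhammer (x + of_nat m - of_nat k) k"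
      by (subst pochhammer_minus) (simp add: algebra_simps)
    moreover have "(- 1) ^ m = (- 1) ^ k * ((- 1) ^ (m - k) :: 'a)" using k by (simp flip: power_add)
    moreover have "(- 1) ^ i * ((- 1) ^ i * c) = (c :: 'a)" for i c
      by (simp flip: mult.assoc power_mult_distrib)
    ultimately show "of_nat (m choose k) * (\<Prod>j=m-k..<m. x + of_nat j)
            * pochhammer (y - of_nat (m - k) + 1) (m - k)
       = (- 1) ^ m * (of_nat (m choose k) * pochhammer (- (x + of_nat m - 1)) k * pochhammer (- y) (m - k))"
      by (simp add: pochhammer_minus mult_ac)
  qed
  also have "\<dots> = (- 1) ^ m * pochhammer (- (x + of_nat m - 1) + (- y)) m"
    by (subst pochhammer_binomial_sum) (simp add: sum_distrib_left)
  also have "- (x + of_nat m - 1) + (- y) = - (x + y + of_nat m - 1)" by simp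
  also have "(- 1) ^ m * pochhammer (- (x + y + of_nat m - 1)) m = pochhammer (x + y) m"
    by (subst pochhammer_minus) (simp flip: mult.assoc power_mult_distrib)
  finally show ?thesis .
qed

text \<open>
  Powers of \<open>z\<close> are eigenfunctions of the Cauchy-Euler operator, with eigenvalue
  \<open>(\<mu> + i)(\<mu> + i + 1) \<dots> (\<mu> + i + m - 1)\<close> on \<open>z^i\<close>.
\<close>
lemma disc_series_cauchy_euler:
  assumes "disc_series f c"
  shows "disc_series
     (\<lambda>z. \<Sum>k=0..m. of_nat (m choose k) * of_real (\<Prod>j=m-k..<m. \<mu> + real j)
                    * z ^ (m - k) * (deriv ^^ (m - k)) f z)
     (\<lambda>i. of_real (pochhammer (\<mu> + real i) m) * c i)"
proof -
  have "disc_series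
     (\<lambda>z. \<Sum>k\<le>m. (of_nat (m choose k) * of_real (\<Prod>j=m-k..<m. \<mu> + real j))
                    * (z ^ (m - k) * (deriv ^^ (m - k)) f z))
     (\<lambda>i. \<Sum>k\<le>m. (of_nat (m choose k) * of_real (\<Prod>j=m-k..<m. \<mu> + real j))
                    * (pochhammer (of_nat i - of_nat (m - k) + 1) (m - k) * c i))"
    by (intro disc_series_sum disc_series_cmult disc_series_deriv_power assms)
  moreover have "(\<Sum>k\<le>m. (of_nat (m choose k) * of_real (\<Prod>j=m-k..<m. \<mu> + real j))
                    * (pochhammer (of_nat i - of_nat (m - k) + 1) (m - k) * c i))
      = of_real (pochhammer (\<mu> + real i) m) * c i" for i
    using arg_cong[OF pochhammer_binomial_falling[of m "of_real \<mu> :: complex" "of_nat i"], of "\<lambda>s. s * c i"]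
    by (simp add: sum_distrib_right mult.assoc flip: pochhammer_of_real)
  ultimately show ?thesis by (simp add: atLeast0AtMost mult.assoc)
qed

lemma cauchy_euler_iff_coeffs:
  assumes f: "disc_series f c" and g: "disc_series g b"
  shows "(\<forall>z\<in>unit_disc.
        (\<Sum>k=0..m. of_nat (m choose k) * of_real (\<Prod>j=m-k..<m. \<mu> + real j)
                    * z ^ (m - k) * (deriv ^^ (m - k)) f z)
        = g z * of_real (\<Prod>j=0..<m. \<mu> + real j + 1)) \<longleftrightarrow>
     (\<forall>k. of_real (pochhammer (\<mu> + real k) m) * c k = of_real (pochhammer (\<mu> + 1) m) * b k)"
  (is "(\<forall>z\<in>_. ?L z = ?R z) \<longleftrightarrow> (\<forall>k. ?l k = ?r k)")
proof -
  have "(\<Prod>j=0..<m. \<mu> + real j + 1) = pochhammer (\<mu> + 1) m"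
    by (simp add: pochhammer_prod add_ac)
  then have "disc_series ?R ?r"
    using disc_series_cmult[OF g, of "of_real (pochhammer (\<mu> + 1) m)"] by (simp add: mult.commute[of "g _"])
  moreover have "disc_series ?L ?l" by (rule disc_series_cauchy_euler[OF f])
  ultimately have L: "disc_series ?L ?l" and R: "disc_series ?R ?r" by blast+
  show ?thesis
  proof
    assume "\<forall>z\<in>unit_disc. ?L z = ?R z"
    then show "\<forall>k. ?l k = ?r k" using disc_series_unique[OF L R] by blast
  next
    assume "\<forall>k. ?l k = ?r k"
    then have "?l = ?r" by (intro ext) blast
    then have "disc_series ?R ?l" using R by (simp only:)
    then show "\<forall>z\<in>unit_disc. ?L z = ?R z" using disc_series_eq[OF L] by blast
  qed
qed

section \<open>Coefficients in the class S\<close>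

lemma disc_series_mix:
  assumes "disc_series f c"
  shows "disc_series (mix l f) (\<lambda>k. (1 + (of_nat k - 1) * of_real l) * c k)"
proof -
  have "disc_series (\<lambda>z. of_real l * (z * deriv f z) + (1 - of_real l) * f z)
     (\<lambda>k. of_real l * (of_nat k * c k) + (1 - of_real l) * c k)"
    by (intro disc_series_add disc_series_cmult disc_series_times_deriv assms)
  then show ?thesis unfolding mix_def by (simp add: algebra_simps)
qed

lemma one_plus_real_mult_nonzero:
  assumes "\<bar>B\<bar> \<le> 1" "cmod w < 1"
  shows "1 + of_real B * w \<noteq> 0"
proof
  assume "1 + of_real B * w = 0"
  then have "of_real B * w = - 1" by (simp add: add_eq_0_iff)
  then have "\<bar>B\<bar> * cmod w = 1" by (metis norm_minus_cancel norm_mult norm_of_real norm_one)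
  moreover have "\<bar>B\<bar> * cmod w \<le> 1 * cmod w" using assms by (intro mult_right_mono) auto
  ultimately show False using assms by simp
qed

text \<open>
  For \<open>F = mix l g\<close> the subordination says \<open>z F' / F - 1 = \<gamma> (A - B) \<omega> / (1 + B \<omega>)\<close>. Clearing both
  denominators leaves an equation that is linear in \<open>F\<close> and has the form required by the
  Clunie inequality.
\<close>
lemma class_S_schwarz_equation:
  assumes "\<gamma> \<noteq> 0" "-1 \<le> B" "B < A" "A \<le> 1" and g: "g \<in> class_S l \<gamma> A B"
  obtains \<omega> where "\<omega> holomorphic_on unit_disc" "\<And>z. z \<in> unit_disc \<Longrightarrow> cmod (\<omega> z) < 1" "\<omega> 0 = 0"
    "\<And>z. z \<in> unit_disc \<Longrightarrow> z * deriv (mix l g) z - mix l g z =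
      \<omega> z * (\<gamma> * of_real (A - B) * mix l g z - of_real B * (z * deriv (mix l g) z - mix l g z))"
proof -
  let ?F = "mix l g"
  from g obtain \<omega> where \<omega>: "\<omega> holomorphic_on unit_disc" "\<omega> ` unit_disc \<subseteq> unit_disc" "\<omega> 0 = 0"
    and sub: "\<And>z. z \<in> unit_disc \<Longrightarrow> 1 + 1 / \<gamma> * (log_deriv_quot ?F z - 1)
      = (1 + of_real A * \<omega> z) / (1 + of_real B * \<omega> z)"
    unfolding class_S_def subordinate_def by auto
  from g have nz: "\<And>z. z \<in> unit_disc - {0} \<Longrightarrow> ?F z \<noteq> 0" and g0: "g 0 = 0"
    by (auto simp: class_S_def class_A_def)
  show thesis
  proof (rule that[OF \<omega>(1) _ \<omega>(3)])
    fix z :: complex assume z: "z \<in> unit_disc"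
    show w: "cmod (\<omega> z) < 1" using \<omega>(2) z by force
    show "z * deriv ?F z - ?F z =
      \<omega> z * (\<gamma> * of_real (A - B) * ?F z - of_real B * (z * deriv ?F z - ?F z))"
    proof (cases "z = 0")
      case True
      then show ?thesis by (simp add: mix_def g0)
    next
      case False
      with z nz have F: "?F z \<noteq> 0" by blast
      have B: "1 + of_real B * \<omega> z \<noteq> 0"
        using assms w by (intro one_plus_real_mult_nonzero) auto
      have "1 / \<gamma> * (z * deriv ?F z / ?F z - 1) = of_real (A - B) * \<omega> z / (1 + of_real B * \<omega> z)"
        using sub[OF z] B False by (simp add: log_deriv_quot_def field_simps)
      then show ?thesis using F B assms(1) by (simp add: field_simps)
    qed
  qed
qed

text \<open>
  In the preceding equation the left-hand side has the coefficients \<open>(k - 1) c\<^sub>k\<close>, and the factor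
  next to \<open>\<omega>\<close> has the coefficients \<open>(\<gamma> (A - B) - (k - 1) B) c\<^sub>k\<close>. The Clunie inequality compares their square sums; the terms with
  equal index are collected, and the index is shifted so that it starts with \<open>c\<^sub>1\<close>.
\<close>
lemma class_S_coeff_inequality:
  assumes "\<gamma> \<noteq> 0" "-1 \<le> B" "B < A" "A \<le> 1" and g: "g \<in> class_S l \<gamma> A B"
    and c: "disc_series (mix l g) c"
  shows "(real j * cmod (c (Suc j)))\<^sup>2 \<le>
    (\<Sum>i<j. ((cmod (\<gamma> * of_real (A - B) - of_real (real i * B)))\<^sup>2 - (real i)\<^sup>2) * (cmod (c (Suc i)))\<^sup>2)"
proof -
  let ?F = "mix l g"
  obtain \<omega> where \<omega>: "\<omega> holomorphic_on unit_disc" "\<And>z. z \<in> unit_disc \<Longrightarrow> cmod (\<omega> z) < 1" "\<omega> 0 = 0"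
    and eq: "\<And>z. z \<in> unit_disc \<Longrightarrow> z * deriv ?F z - ?F z =
      \<omega> z * (\<gamma> * of_real (A - B) * ?F z - of_real B * (z * deriv ?F z - ?F z))"
    using class_S_schwarz_equation[OF assms(1-5)] by blast
  have c0: "c 0 = 0"
    using disc_series_at_0[OF c] g by (simp add: mix_def class_S_def class_A_def)
  have P: "disc_series (\<lambda>z. z * deriv ?F z - ?F z) (\<lambda>k. of_nat k * c k - c k)"
    by (intro disc_series_diff disc_series_times_deriv c)
  have D: "disc_series (\<lambda>z. \<gamma> * of_real (A - B) * ?F z - of_real B * (z * deriv ?F z - ?F z))
     (\<lambda>k. \<gamma> * of_real (A - B) * c k - of_real B * (of_nat k * c k - c k))"
    by (intro disc_series_diff disc_series_cmult P c)
  have "(\<Sum>k<Suc (Suc j). (cmod (of_nat k * c k - c k))\<^sup>2) \<le>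
     (\<Sum>k<Suc j. (cmod (\<gamma> * of_real (A - B) * c k - of_real B * (of_nat k * c k - c k)))\<^sup>2)"
    by (rule clunie_inequality[OF \<omega>(1) less_imp_le[OF \<omega>(2)] \<omega>(3) P D eq])
  then have "(\<Sum>i<Suc j. (cmod (of_nat i * c (Suc i)))\<^sup>2) \<le>
     (\<Sum>i<j. (cmod ((\<gamma> * of_real (A - B) - of_real (real i * B)) * c (Suc i)))\<^sup>2)"
    by (simp only: sum.lessThan_Suc_shift[of _ "Suc j"] sum.lessThan_Suc_shift[of _ j])
      (simp add: c0 algebra_simps)
  then have "(\<Sum>i<Suc j. (real i)\<^sup>2 * (cmod (c (Suc i)))\<^sup>2) \<le>
     (\<Sum>i<j. (cmod (\<gamma> * of_real (A - B) - of_real (real i * B)))\<^sup>2 * (cmod (c (Suc i)))\<^sup>2)"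
    by (simp only: norm_mult norm_of_nat power_mult_distrib)
  then show ?thesis
    unfolding left_diff_distrib sum_subtractf by (simp add: power_mult_distrib)
qed

section \<open>Coefficients in the class K\<close>

lemma coeff_has_expansion:
  assumes c: "disc_series f c" and a: "has_expansion f a" and "2 \<le> n"
  shows "a n = c n"
proof -
  define b where "b = (\<lambda>k. if k = 0 then 0 else if k = 1 then 1 else a k)"
  have "disc_series f b"
    unfolding disc_series_def
  proof
    fix z assume "z \<in> unit_disc"
    then have "(\<lambda>k. b (k + 2) * z ^ (k + 2)) sums (f z - z)"
      using a by (auto simp: has_expansion_def b_def)
    then have "(\<lambda>k. b k * z ^ k) sums (f z - z + (\<Sum>k<2. b k * z ^ k))"
      by (subst (asm) sums_iff_shift) simp
    then show "(\<lambda>k. b k * z ^ k) sums f z" by (simp add: numeral_2_eq_2 b_def)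
  qed
  from disc_series_unique[OF c this, of n] show ?thesis using \<open>2 \<le> n\<close> by (simp add: b_def)
qed

lemma disc_series_imp_has_expansion:
  assumes "disc_series f c" "c 0 = 0" "c 1 = 1"
  shows "has_expansion f c"
  unfolding has_expansion_def
proof
  fix z assume "z \<in> unit_disc"
  from disc_seriesD[OF assms(1) this]
  have "(\<lambda>k. c (k + 2) * z ^ (k + 2)) sums (f z - (\<Sum>k<2. c k * z ^ k))"
    by (subst sums_iff_shift) simp
  then show "(\<lambda>j. c (j + 2) * z ^ (j + 2)) sums (f z - z)"
    using assms by (simp add: numeral_2_eq_2)
qed

lemma class_A_iff:
  assumes "disc_series f c"
  shows "f \<in> class_A \<longleftrightarrow> c 0 = 0 \<and> c 1 = 1"
  using disc_series_holomorphic[OF assms] disc_series_at_0[OF assms] disc_series_deriv_at_0[OF assms]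
  by (auto simp: class_A_def)

lemma mix_coeff_pos: "0 \<le> l \<Longrightarrow> 1 \<le> 1 + real j * l"
  by simp

text \<open>
  Both passages, from \<open>f\<close> to \<open>g\<close> by the Cauchy-Euler equation and from \<open>g\<close> to \<open>mix l g\<close>, are diagonal
  on coefficients. As \<open>\<mu> > -1\<close>, the multipliers are positive from the first coefficient on.
\<close>
lemma class_K_coeff:
  assumes f: "f \<in> class_K l \<gamma> A B m \<mu>" "has_expansion f a"
    and "0 \<le> l" "-1 < \<mu>" "1 \<le> j"
  obtains g c where "g \<in> class_S l \<gamma> A B" "disc_series (mix l g) c" "c 1 = 1"
    "cmod (a (Suc j)) = cmod (c (Suc j)) / (1 + real j * l)
        * (pochhammer (\<mu> + 1) m / pochhammer (\<mu> + real (Suc j)) m)"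
proof -
  from f(1) obtain g where g: "g \<in> class_S l \<gamma> A B" and fA: "f \<in> class_A"
    and ode: "\<forall>z\<in>unit_disc.
        (\<Sum>k=0..m. of_nat (m choose k) * of_real (\<Prod>j=m-k..<m. \<mu> + real j)
                    * z ^ (m - k) * (deriv ^^ (m - k)) f z)
        = g z * of_real (\<Prod>j=0..<m. \<mu> + real j + 1)"
    by (auto simp: class_K_def)
  have gA: "g \<in> class_A" using g by (simp add: class_S_def)
  obtain b where b: "disc_series g b" using gA holomorphic_disc_series by (force simp: class_A_def)
  obtain d where d: "disc_series f d" using fA holomorphic_disc_series by (force simp: class_A_def)
  define c where "c = (\<lambda>k. (1 + (of_nat k - 1) * of_real l) * b k)"
  have c: "disc_series (mix l g) c" unfolding c_def by (rule disc_series_mix[OF b])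
  have c1: "c 1 = 1" using gA by (simp add: c_def class_A_iff[OF b])
  have "c (Suc j) = of_real (1 + real j * l) * b (Suc j)" by (simp add: c_def)
  then have cb: "cmod (c (Suc j)) = (1 + real j * l) * cmod (b (Suc j))"
    using mix_coeff_pos[OF \<open>0 \<le> l\<close>, of j] by (metis norm_mult norm_of_real abs_of_nonneg order_trans zero_le_one)
  have pos: "pochhammer (\<mu> + real (Suc i)) m > 0" for i
    using \<open>-1 < \<mu>\<close> by (intro pochhammer_pos) simp
  have "of_real (pochhammer (\<mu> + real (Suc j)) m) * d (Suc j) = of_real (pochhammer (\<mu> + 1) m) * b (Suc j)"
    using ode cauchy_euler_iff_coeffs[OF d b] by blast
  then have "cmod (of_real (pochhammer (\<mu> + real (Suc j)) m) * d (Suc j)) = cmod (of_real (pochhammer (\<mu> + 1) m) * b (Suc j))"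
    by (rule arg_cong)
  then have "pochhammer (\<mu> + real (Suc j)) m * cmod (d (Suc j)) = pochhammer (\<mu> + 1) m * cmod (b (Suc j))"
    using pos[of j] pos[of 0] by (simp add: norm_mult)
  then have "cmod (d (Suc j)) = cmod (b (Suc j)) * (pochhammer (\<mu> + 1) m / pochhammer (\<mu> + real (Suc j)) m)"
    using pos[of j] by (metis less_irrefl mult.commute nonzero_mult_div_cancel_left times_divide_eq_right)
  moreover have "a (Suc j) = d (Suc j)"
    using coeff_has_expansion[OF d f(2)] \<open>1 \<le> j\<close> by simp
  moreover have "cmod (c (Suc j)) / (1 + real j * l) = cmod (b (Suc j))"
    unfolding cb using mix_coeff_pos[OF \<open>0 \<le> l\<close>, of j] by auto
  ultimately have "cmod (a (Suc j)) = cmod (c (Suc j)) / (1 + real j * l)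
        * (pochhammer (\<mu> + 1) m / pochhammer (\<mu> + real (Suc j)) m)"
    by simp
  then show thesis by (rule that[OF g c c1])
qed

lemma class_K_coeff_bound:
  fixes \<gamma> A B
  defines "\<alpha> \<equiv> \<lambda>i. cmod (\<gamma> * of_real (A - B) - of_real (real i * B))"
  assumes "\<gamma> \<noteq> 0" "0 \<le> l" "-1 \<le> B" "B < A" "A \<le> 1" "-1 < \<mu>"
    and f: "f \<in> class_K l \<gamma> A B m \<mu>" "has_expansion f a"
    and K: "1 \<le> K" "K \<le> j" "\<And>i. i < K \<Longrightarrow> real i \<le> \<alpha> i"
    and tail: "\<And>i. K \<le> i \<Longrightarrow> i < j \<Longrightarrow> \<alpha> i \<le> real i"
  shows "cmod (a (Suc j)) \<le> (\<Prod>i<K. \<alpha> i) / (real j * fact (K - 1) * (1 + real j * l))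
      * (pochhammer (\<mu> + 1) m / pochhammer (\<mu> + real (Suc j)) m)"
proof -
  have j: "1 \<le> j" using K by simp
  obtain g c where g: "g \<in> class_S l \<gamma> A B" and c: "disc_series (mix l g) c" "c 1 = 1"
    and eq: "cmod (a (Suc j)) = cmod (c (Suc j)) / (1 + real j * l)
        * (pochhammer (\<mu> + 1) m / pochhammer (\<mu> + real (Suc j)) m)"
    by (rule class_K_coeff[OF f assms(3,7) j])
  have "real j * cmod (c (Suc j)) \<le> (\<Prod>i<K. \<alpha> i) / fact (K - 1)"
  proof (rule recursive_square_bound[OF _ _ _ K])
    show "(real j * cmod (c (Suc j)))\<^sup>2 \<le> (\<Sum>i<j. ((\<alpha> i)\<^sup>2 - (real i)\<^sup>2) * (cmod (c (Suc i)))\<^sup>2)" for j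
      unfolding \<alpha>_def by (rule class_S_coeff_inequality[OF assms(2,4-6) g c(1)])
  qed (use c tail in \<open>auto simp: \<alpha>_def\<close>)
  then have "cmod (c (Suc j)) \<le> (\<Prod>i<K. \<alpha> i) / (real j * fact (K - 1))"
    using j by (simp add: field_simps)
  then have "cmod (c (Suc j)) / (1 + real j * l) \<le> (\<Prod>i<K. \<alpha> i) / (real j * fact (K - 1)) / (1 + real j * l)"
    using \<open>0 \<le> l\<close> by (intro divide_right_mono) auto
  moreover have "0 \<le> pochhammer (\<mu> + 1) m / pochhammer (\<mu> + real (Suc j)) m"
    using \<open>-1 < \<mu>\<close> by (intro divide_nonneg_nonneg less_imp_le[OF pochhammer_pos]) auto
  ultimately show ?thesis
    unfolding eq by (intro mult_right_mono) (simp_all add: mult.assoc)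
qed

section \<open>Extremal functions\<close>

text \<open>
  The solution of \<open>z F' / F - 1 = \<kappa> \<omega> / (1 + B \<omega>)\<close> for \<open>\<omega>(z) = z^p\<close>. In closed form it is \<open>z (1 + B z^p)^(\<kappa> / (p B))\<close>, or \<open>z exp (\<kappa> z^p / p)\<close> for \<open>B = 0\<close>. Writing it as \<open>z exp H\<close> with a
  primitive \<open>H\<close> avoids the branch of the power and the case distinction, and makes the absence of
  zeros evident. The recursion for its coefficients is the linear equation
  \<open>z F' - F = z^p (\<kappa> F - B (z F' - F))\<close> read off at \<open>z^(k+p)\<close>.
\<close>
lemma janowski_extremal_function:
  assumes B: "\<bar>B\<bar> \<le> 1" and p: "1 \<le> p"
  obtains F c where "disc_series F c" "c 0 = 0" "c 1 = 1"
    "\<And>z. z \<in> unit_disc - {0} \<Longrightarrow> F z \<noteq> 0"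
    "\<And>z. z \<in> unit_disc \<Longrightarrow> z * deriv F z = F z * (1 + \<kappa> * z ^ p / (1 + of_real B * z ^ p))"
    "\<And>k. of_nat (k + p - 1) * c (k + p) = (\<kappa> - of_real B * (of_nat k - 1)) * c k"
proof -
  have nz: "1 + of_real B * z ^ p \<noteq> 0" if "z \<in> unit_disc" for z
  proof (rule one_plus_real_mult_nonzero[OF B])
    show "cmod (z ^ p) < 1" using that p by (simp add: norm_power power_less_one_iff)
  qed
  have "(\<lambda>z. \<kappa> * z ^ (p - 1) / (1 + of_real B * z ^ p)) holomorphic_on unit_disc"
    by (intro holomorphic_intros) (use nz in auto)
  then obtain H where H: "\<And>z. z \<in> unit_disc \<Longrightarrow>
      (H has_field_derivative \<kappa> * z ^ (p - 1) / (1 + of_real B * z ^ p)) (at z)"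
    by (rule holomorphic_convex_primitive'[OF convex_ball open_ball])
      (metis at_within_open open_ball)
  define F where "F = (\<lambda>z. z * exp (H z - H 0))"
  have F': "(F has_field_derivative exp (H z - H 0) * (1 + \<kappa> * z ^ p / (1 + of_real B * z ^ p))) (at z)"
    if "z \<in> unit_disc" for z
  proof -
    have "(F has_field_derivative 1 * exp (H z - H 0)
        + exp (H z - H 0) * (\<kappa> * z ^ (p - 1) / (1 + of_real B * z ^ p) - 0) * z) (at z)"
      unfolding F_def
      by (intro DERIV_mult DERIV_ident DERIV_chain2[of exp] DERIV_exp DERIV_diff DERIV_const H that)
    moreover have "1 * e + e * (\<kappa> * w / X - 0) * z = e * (1 + \<kappa> * (w * z) / X)" for e w X
      by (simp add: distrib_left mult.assoc)
    moreover have "z ^ (p - 1) * z = z ^ p"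
      using p by (intro power_minus_mult) simp
    ultimately show ?thesis by (simp only:)
  qed
  have "F holomorphic_on unit_disc"
    unfolding holomorphic_on_open[OF open_ball]
  proof
    fix z :: complex assume "z \<in> unit_disc"
    from F'[OF this] show "\<exists>f'. (F has_field_derivative f') (at z)" ..
  qed
  then obtain c where c: "disc_series F c" using holomorphic_disc_series by blast
  have ode: "z * deriv F z = F z * (1 + \<kappa> * z ^ p / (1 + of_real B * z ^ p))"
    if "z \<in> unit_disc" for z
    unfolding DERIV_imp_deriv[OF F'[OF that]] by (simp only: F_def mult.assoc)
  have c0: "c 0 = 0" using disc_series_at_0[OF c] by (simp add: F_def)
  have "c 1 = deriv F 0" by (rule disc_series_deriv_at_0[OF c])
  also have "\<dots> = 1" using DERIV_imp_deriv[OF F'[of 0]] p by (simp add: power_0_left)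
  finally have c1: "c 1 = 1" .
  have cancel: "(w * (1 + u * v / X) - w) * X = u * w * v" if "X \<noteq> 0" for u v w X :: complex
    using that by (simp add: field_simps)
  have solve: "a = q * (k * f - b * a)" if "a * (1 + b * q) = k * f * q" for a b f k q :: complex
    using that by algebra
  have rec: "of_nat (k + p - 1) * c (k + p) = (\<kappa> - of_real B * (of_nat k - 1)) * c k" for k
  proof -
    have P: "disc_series (\<lambda>z. z * deriv F z - F z) (\<lambda>k. of_nat k * c k - c k)"
      by (intro disc_series_diff disc_series_times_deriv c)
    have D: "disc_series (\<lambda>z. z ^ p * (\<kappa> * F z - of_real B * (z * deriv F z - F z)))
       (\<lambda>k. if k < p then 0 else \<kappa> * c (k - p) - of_real B * (of_nat (k - p) * c (k - p) - c (k - p)))"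
      by (intro disc_series_power_mult disc_series_diff disc_series_cmult P c)
    have "of_nat (k + p) * c (k + p) - c (k + p) = \<kappa> * c k - of_real B * (of_nat k * c k - c k)"
    proof -
      have "z * deriv F z - F z = z ^ p * (\<kappa> * F z - of_real B * (z * deriv F z - F z))"
        if z: "z \<in> unit_disc" for z
      proof -
        have "(z * deriv F z - F z) * (1 + of_real B * z ^ p) = \<kappa> * F z * z ^ p"
          unfolding ode[OF z] by (rule cancel[OF nz[OF z]])
        then show ?thesis by (rule solve)
      qed
      from disc_series_unique[OF P D this, of "k + p"] show ?thesis by simp
    qed
    moreover have "of_nat (k + p - 1) * c (k + p) = of_nat (k + p) * c (k + p) - c (k + p)"
      using p by (simp add: of_nat_diff left_diff_distrib)
    moreover have "\<kappa> * c k - of_real B * (of_nat k * c k - c k) = (\<kappa> - of_real B * (of_nat k - 1)) * c k"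
      by (simp add: left_diff_distrib right_diff_distrib mult.assoc)
    ultimately show ?thesis by metis
  qed
  show thesis
    by (rule that[OF c c0 c1 _ ode rec]) (simp_all add: F_def)
qed

text \<open>
  The recursion is that of the coefficients of \<open>mix l g\<close>, expressed through those of \<open>g\<close>.
\<close>
lemma class_S_extremal:
  assumes "\<gamma> \<noteq> 0" "0 \<le> l" "-1 \<le> B" "B < A" "A \<le> 1" and p: "1 \<le> p"
  obtains g b where "g \<in> class_S l \<gamma> A B" "disc_series g b" "b 0 = 0" "b 1 = 1"
    "\<And>k. of_nat (k + p - 1) * of_real (1 + (real (k + p) - 1) * l) * b (k + p)
       = (\<gamma> * of_real (A - B) - of_real B * (of_nat k - 1)) * of_real (1 + (real k - 1) * l) * b k"
proof -
  have B: "\<bar>B\<bar> \<le> 1" using assms by auto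
  obtain F c where F: "disc_series F c" and c: "c 0 = 0" "c 1 = 1"
    and F0: "\<And>z. z \<in> unit_disc - {0} \<Longrightarrow> F z \<noteq> 0"
    and ode: "\<And>z. z \<in> unit_disc \<Longrightarrow> z * deriv F z
       = F z * (1 + \<gamma> * of_real (A - B) * z ^ p / (1 + of_real B * z ^ p))"
    and rec: "\<And>k. of_nat (k + p - 1) * c (k + p) = (\<gamma> * of_real (A - B) - of_real B * (of_nat k - 1)) * c k"
    using janowski_extremal_function[OF B p, of "\<gamma> * of_real (A - B)"] by metis
  \<comment> \<open>At \<open>k = 0\<close> the denominator \<open>1 - l\<close> may be \<open>0\<close> or small; as \<open>c 0 = 0\<close>, the value \<open>0\<close>
    does not change the product.\<close>
  define d where "d = (\<lambda>k. if k = 0 then 0 else 1 / of_real (1 + (real k - 1) * l) :: complex)"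
  have d1: "1 \<le> 1 + (real k - 1) * l" if "k \<noteq> 0" for k
    using assms(2) that by (cases k) auto
  have "cmod (d k) \<le> 1" for k
    using d1[of k] unfolding d_def by (auto simp: norm_divide simp del: of_real_add of_real_mult)
  then obtain g where g: "disc_series g (\<lambda>k. d k * c k)"
    using disc_series_multiplier[OF F] by blast
  have cd: "of_real (1 + (real k - 1) * l) * (d k * c k) = c k" for k
    using d1[of k] c by (cases "k = 0") (auto simp: d_def simp del: of_real_add of_real_mult of_real_diff)
  have "disc_series (mix l g) c"
    using disc_series_mix[OF g, of l] cd by (simp only: of_real_add of_real_mult of_real_diff of_real_1 of_real_of_nat_eq)
  then have mix: "mix l g z = F z" if "z \<in> unit_disc" for z
    using disc_series_eq F that by blast
  have mix': "deriv (mix l g) z = deriv F z" if "z \<in> unit_disc" for z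
    by (rule deriv_cong_ev) (use that mix in \<open>auto intro: eventually_mono[OF eventually_nhds_in_open[of unit_disc]]\<close>)
  have zp: "cmod (z ^ p) < 1" if "z \<in> unit_disc" for z :: complex
    using that p by (simp add: norm_power power_less_one_iff)
  have nz: "1 + of_real B * z ^ p \<noteq> 0" if "z \<in> unit_disc" for z
    using one_plus_real_mult_nonzero[OF B zp[OF that]] .
  have val: "1 + 1 / \<gamma> * (log_deriv_quot (mix l g) z - 1) = (1 + of_real A * z ^ p) / (1 + of_real B * z ^ p)"
    if z: "z \<in> unit_disc" for z
  proof (cases "z = 0")
    case True
    then show ?thesis using p by (simp add: log_deriv_quot_def power_0_left)
  next
    case False
    then have "log_deriv_quot (mix l g) z = 1 + \<gamma> * of_real (A - B) * z ^ p / (1 + of_real B * z ^ p)"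
      using z F0[of z] by (simp add: log_deriv_quot_def mix mix' ode)
    then show ?thesis using nz[OF z] assms(1) by (simp add: field_simps)
  qed
  have "subordinate (\<lambda>z. 1 + 1 / \<gamma> * (log_deriv_quot (mix l g) z - 1))
          (\<lambda>z. (1 + of_real A * z) / (1 + of_real B * z))"
    unfolding subordinate_def
  proof (intro conjI exI[of _ "\<lambda>z. z ^ p"] ballI)
    have "(\<lambda>z. (1 + of_real A * z ^ p) / (1 + of_real B * z ^ p)) holomorphic_on unit_disc"
      by (intro holomorphic_intros) (use nz in auto)
    then show "(\<lambda>z. 1 + 1 / \<gamma> * (log_deriv_quot (mix l g) z - 1)) holomorphic_on unit_disc"
      by (rule holomorphic_transform) (rule val[symmetric])
    show "(\<lambda>z. (1 + of_real A * z) / (1 + of_real B * z)) holomorphic_on unit_disc"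
      by (intro holomorphic_intros) (use one_plus_real_mult_nonzero[OF B] in auto)
    show "(\<lambda>z. z ^ p) ` unit_disc \<subseteq> unit_disc" using zp by auto
  qed (use p val in \<open>auto intro: holomorphic_intros\<close>)
  moreover have "g \<in> class_A" using c by (simp add: class_A_iff[OF g] d_def)
  ultimately have gS: "g \<in> class_S l \<gamma> A B" using F0 mix by (auto simp: class_S_def)
  show thesis
  proof (rule that[OF gS g])
    fix k
    show "of_nat (k + p - 1) * of_real (1 + (real (k + p) - 1) * l) * (d (k + p) * c (k + p))
       = (\<gamma> * of_real (A - B) - of_real B * (of_nat k - 1)) * of_real (1 + (real k - 1) * l) * (d k * c k)"
      unfolding mult.assoc cd by (simp only: rec)
  qed (use c in \<open>auto simp: d_def\<close>)
qed

text \<open>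
  Starting from the extremal function with \<open>\<omega>(z) = z^p\<close>, the equation of Cauchy-Euler type is solved
  coefficientwise; the multipliers are bounded by \<open>1\<close> because the eigenvalues increase.
\<close>
lemma class_K_extremal:
  assumes "\<gamma> \<noteq> 0" "0 \<le> l" "-1 \<le> B" "B < A" "A \<le> 1" "-1 < \<mu>" and p: "1 \<le> p"
  obtains f a c where "f \<in> class_K l \<gamma> A B m \<mu>" "has_expansion f a"
    "c 1 = 1" "\<And>k. of_nat (k + p - 1) * c (k + p) = (\<gamma> * of_real (A - B) - of_real B * (of_nat k - 1)) * c k"
    "\<And>j. cmod (a (Suc j)) = cmod (c (Suc j)) / (1 + real j * l)
        * (pochhammer (\<mu> + 1) m / pochhammer (\<mu> + real (Suc j)) m)"
proof -
  obtain g b where gS: "g \<in> class_S l \<gamma> A B" and g: "disc_series g b" and b: "b 0 = 0" "b 1 = 1"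
    and rec: "\<And>k. of_nat (k + p - 1) * of_real (1 + (real (k + p) - 1) * l) * b (k + p)
       = (\<gamma> * of_real (A - B) - of_real B * (of_nat k - 1)) * of_real (1 + (real k - 1) * l) * b k"
    using class_S_extremal[OF assms(1-5) p] by blast
  \<comment> \<open>At \<open>k = 0\<close> the quotient could have denominator \<open>0\<close> or exceed \<open>1\<close>; as \<open>b 0 = 0\<close>, the value \<open>0\<close>
    does not change the product.\<close>
  define \<rho> where "\<rho> = (\<lambda>k. if k = 0 then 0 else pochhammer (\<mu> + 1) m / pochhammer (\<mu> + real k) m)"
  have pos: "pochhammer (\<mu> + real (Suc k)) m > 0" for k
    using \<open>-1 < \<mu>\<close> by (intro pochhammer_pos) simp
  have \<rho>0: "0 \<le> \<rho> k" for k
    using pos[of 0] pos[of "k - 1"] by (cases k) (auto simp: \<rho>_def)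
  have mono: "pochhammer (\<mu> + 1) m \<le> pochhammer (\<mu> + real (Suc k)) m" for k
    unfolding pochhammer_prod using \<open>-1 < \<mu>\<close> by (intro prod_mono) auto
  have \<rho>1: "\<rho> k \<le> 1" for k
    using pos[of "k - 1"] mono[of "k - 1"] by (cases k) (auto simp: \<rho>_def)
  obtain f where f: "disc_series f (\<lambda>k. of_real (\<rho> k) * b k)"
    using disc_series_multiplier[OF g, of "\<lambda>k. of_real (\<rho> k)"] \<rho>0 \<rho>1 by (auto simp: abs_of_nonneg)
  let ?a = "\<lambda>k. of_real (\<rho> k) * b k"
  have a01: "?a 0 = 0" "?a 1 = 1" using b pos[of 0] by (auto simp: \<rho>_def)
  have "of_real (pochhammer (\<mu> + real k) m) * ?a k = of_real (pochhammer (\<mu> + 1) m) * b k" for k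
    using pos[of "k - 1"] b by (cases k) (auto simp: \<rho>_def)
  then have "\<forall>z\<in>unit_disc.
        (\<Sum>k=0..m. of_nat (m choose k) * of_real (\<Prod>j=m-k..<m. \<mu> + real j)
                    * z ^ (m - k) * (deriv ^^ (m - k)) f z)
        = g z * of_real (\<Prod>j=0..<m. \<mu> + real j + 1)"
    by (subst cauchy_euler_iff_coeffs[OF f g]) blast
  moreover have "f \<in> class_A" using a01 class_A_iff[OF f] by simp
  ultimately have fK: "f \<in> class_K l \<gamma> A B m \<mu>"
    using gS unfolding class_K_def by blast
  define c where "c = (\<lambda>k. of_real (1 + (real k - 1) * l) * b k)"
  show thesis
  proof (rule that[OF fK disc_series_imp_has_expansion[OF f a01], of c])
    show "c 1 = 1" using b by (simp add: c_def)
  next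
    show "of_nat (k + p - 1) * c (k + p) = (\<gamma> * of_real (A - B) - of_real B * (of_nat k - 1)) * c k" for k
      using rec[of k] by (simp only: c_def mult.assoc)
    show "cmod (?a (Suc j)) = cmod (c (Suc j)) / (1 + real j * l)
        * (pochhammer (\<mu> + 1) m / pochhammer (\<mu> + real (Suc j)) m)" for j
    proof -
      have l: "1 + real j * l > 0" using \<open>0 \<le> l\<close> by (simp add: add_pos_nonneg)
      have "c (Suc j) = of_real (1 + real j * l) * b (Suc j)" by (simp add: c_def)
      then have "cmod (c (Suc j)) = (1 + real j * l) * cmod (b (Suc j))"
        using l by (simp only: norm_mult norm_of_real abs_of_pos)
      moreover have "cmod (?a (Suc j)) = \<rho> (Suc j) * cmod (b (Suc j))"
        using \<rho>0[of "Suc j"] by (simp add: norm_mult)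
      ultimately show ?thesis using l by (simp add: \<rho>_def)
    qed
  qed
qed

text \<open>
  For \<open>p = 1\<close> the recursion of the extremal function has one step per index, so its solution
  attains the product \<open>Q j\<close> from the recursive inequality.
\<close>
lemma extremal_product:
  fixes c :: "nat \<Rightarrow> complex"
  assumes "c 1 = 1" "\<And>k. of_nat (k + 1 - 1) * c (k + 1) = (\<kappa> - of_real B * (of_nat k - 1)) * c k"
  shows "cmod (c (Suc j)) = (\<Prod>i<j. cmod (\<kappa> - of_real (real i * B))) / fact j"
proof (induction j)
  case (Suc j)
  have "of_nat (Suc j) * c (Suc (Suc j)) = (\<kappa> - of_real (real j * B)) * c (Suc j)"
    using assms(2)[of "Suc j"] by (simp add: mult.commute)
  then have "real (Suc j) * cmod (c (Suc (Suc j))) = cmod (\<kappa> - of_real (real j * B)) * cmod (c (Suc j))"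
    by (metis norm_mult norm_of_nat)
  with Suc show ?case by (simp add: field_simps del: of_nat_Suc)
qed (use assms in simp)

lemma Acoef_Suc: "Acoef \<gamma> A B (Suc i) = cmod (\<gamma> * of_real (A - B) - of_real (real i * B)) - real i"
  by (simp add: Acoef_def mult.commute)

text \<open>
  Raising the index by one changes the modulus in \<^const>\<open>Acoef\<close> by at most \<open>\<bar>B\<bar> \<le> 1\<close>, while the
  subtracted term grows by \<open>1\<close>. Hence a nonnegative value at one index entails nonnegative
  weights at all smaller ones, and a nonpositive value entails nonpositive weights at all larger ones.
\<close>
lemma Acoef_antimono:
  assumes "\<bar>B\<bar> \<le> 1" "1 \<le> i" "i \<le> j"
  shows "Acoef \<gamma> A B j \<le> Acoef \<gamma> A B i"
  using assms(3)
proof (induction j rule: dec_induct)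
  case (step k)
  then obtain i where k: "k = Suc i" using assms(2) by (cases k) auto
  have "cmod (\<gamma> * of_real (A - B) - of_real (real (Suc i) * B))
     \<le> cmod (\<gamma> * of_real (A - B) - of_real (real i * B)) + cmod (of_real B)"
    using norm_triangle_ineq4[of "\<gamma> * of_real (A - B) - of_real (real i * B)" "of_real B"]
    by (simp add: algebra_simps)
  then have "Acoef \<gamma> A B (Suc k) \<le> Acoef \<gamma> A B k"
    using assms(1) unfolding k Acoef_Suc by simp
  with step.IH show ?case by simp
qed simp

section \<open>The sharp coefficient estimates\<close>

theorem theorem2p2:
  fixes \<gamma> :: complex and l A B \<mu> :: real and m n :: nat
  assumes "\<gamma> \<noteq> 0" and "0 \<le> l" and "l \<le> 1"
    and "-1 \<le> B" and "B < A" and "A \<le> 1"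
    and "m \<ge> 2" and "\<mu> > -1" and "n \<ge> 2"
  defines "bound1 \<equiv>
      cmod \<gamma> * (A - B) / ((real n - 1) * (1 + (real n - 1) * l))
      * ((\<Prod>j=0..m-1. \<mu> + real j + 1) / (\<Prod>j=0..m-1. \<mu> + real j + real n))"
    and "bound2 \<equiv>
      (\<Prod>j=0..n-2. cmod (\<gamma> * of_real (A - B) - of_real (real j * B)))
        / (fact (n - 1) * (1 + l * (real n - 1)))
      * ((\<Prod>j=0..m-1. \<mu> + real j + 1) / (\<Prod>j=0..m-1. \<mu> + real j + real n))"
    and "bound3 \<equiv> \<lambda>k::nat.
      (\<Prod>j=0..k-1. cmod (\<gamma> * of_real (A - B) - of_real (real j * B)))
        / ((real n - 1) * fact (k - 1) * (1 + l * (real n - 1)))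
      * ((\<Prod>j=0..m-1. \<mu> + real j + 1) / (\<Prod>j=0..m-1. \<mu> + real j + real n))"
  shows
    "(\<forall>f a. f \<in> class_K l \<gamma> A B m \<mu> \<and> has_expansion f a \<longrightarrow>
        (Acoef \<gamma> A B 2 \<le> 0 \<longrightarrow> cmod (a n) \<le> bound1) \<and>
        (Acoef \<gamma> A B (n - 1) \<ge> 0 \<longrightarrow> cmod (a n) \<le> bound2) \<and>
        (\<forall>k\<in>{2..n-2}. Acoef \<gamma> A B k \<ge> 0 \<and> Acoef \<gamma> A B (k + 1) \<le> 0 \<longrightarrow>
           cmod (a n) \<le> bound3 k)) \<and>
     (Acoef \<gamma> A B 2 \<le> 0 \<longrightarrow>
        (\<exists>f a. f \<in> class_K l \<gamma> A B m \<mu> \<and> has_expansion f a \<and> cmod (a n) = bound1)) \<and>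
     (Acoef \<gamma> A B (n - 1) \<ge> 0 \<longrightarrow>
        (\<exists>f a. f \<in> class_K l \<gamma> A B m \<mu> \<and> has_expansion f a \<and> cmod (a n) = bound2))"
proof -
  define \<alpha> where "\<alpha> = (\<lambda>i. cmod (\<gamma> * of_real (A - B) - of_real (real i * B)))"
  obtain N where n: "n = Suc N" and N: "1 \<le> N" using \<open>n \<ge> 2\<close> by (cases n) auto
  define R where "R = pochhammer (\<mu> + 1) m / pochhammer (\<mu> + real n) m"
  \<comment> \<open>All three bounds are values of \<open>\<beta>\<close>, at \<open>K = 1\<close>, \<open>K = n - 1\<close> and \<open>K = k\<close>.\<close>
  define \<beta> where "\<beta> = (\<lambda>K. (\<Prod>i<K. \<alpha> i) / (real N * fact (K - 1) * (1 + real N * l)) * R)"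
  have m: "{0..m-1} = {0..<m}" using \<open>m \<ge> 2\<close> by auto
  have R: "(\<Prod>j=0..m-1. \<mu> + real j + 1) / (\<Prod>j=0..m-1. \<mu> + real j + real n) = R"
    unfolding R_def pochhammer_prod m by (simp add: add_ac)
  have \<alpha>0: "\<alpha> 0 = cmod \<gamma> * (A - B)" using \<open>B < A\<close> by (simp add: \<alpha>_def norm_mult flip: of_real_diff)
  have b1: "bound1 = \<beta> 1"
    unfolding bound1_def R \<beta>_def by (simp add: n \<alpha>0)
  have prod_eq: "(\<Prod>j=0..K-1. cmod (\<gamma> * of_real (A - B) - of_real (real j * B))) = (\<Prod>i<K. \<alpha> i)" if "1 \<le> K" for K
    unfolding \<alpha>_def by (rule prod.cong) (use that in auto)
  have b3: "bound3 K = \<beta> K" if "1 \<le> K" for K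
    unfolding bound3_def R \<beta>_def prod_eq[OF that] by (simp add: n mult.commute)
  have "fact N = real N * fact (N - 1)" using N by (intro fact_reduce) auto
  then have b2: "bound2 = \<beta> N"
    unfolding bound2_def R \<beta>_def using prod_eq[OF N] by (simp add: n mult.commute)
  have B: "\<bar>B\<bar> \<le> 1" using assms by auto
  have Acoef: "Acoef \<gamma> A B (Suc i) = \<alpha> i - real i" for i
    by (simp only: Acoef_Suc \<alpha>_def)
  have head: "real i \<le> \<alpha> i" if "0 \<le> Acoef \<gamma> A B K" "i < K" for i K
    using Acoef_antimono[OF B, of "Suc i" K \<gamma> A] that by (simp add: Acoef)
  have tail: "\<alpha> i \<le> real i" if "Acoef \<gamma> A B (Suc K) \<le> 0" "K \<le> i" for i K
    using Acoef_antimono[OF B, of "Suc K" "Suc i" \<gamma> A] that by (simp add: Acoef)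
  have upper: "cmod (a n) \<le> \<beta> K"
    if "f \<in> class_K l \<gamma> A B m \<mu>" "has_expansion f a" "1 \<le> K" "K \<le> N"
      "0 \<le> Acoef \<gamma> A B K" "K < N \<Longrightarrow> Acoef \<gamma> A B (Suc K) \<le> 0" for f a K
    unfolding n \<beta>_def R_def \<alpha>_def
  proof (rule class_K_coeff_bound[OF assms(1,2,4-6,8) that(1-4)])
    show "real i \<le> cmod (\<gamma> * of_real (A - B) - of_real (real i * B))" if "i < K" for i
      using head[OF \<open>0 \<le> Acoef \<gamma> A B K\<close> that] by (simp only: \<alpha>_def)
    show "cmod (\<gamma> * of_real (A - B) - of_real (real i * B)) \<le> real i" if "K \<le> i" "i < N" for i
      using tail[of K i] that \<open>K < N \<Longrightarrow> _\<close> by (simp add: \<alpha>_def)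
  qed
  have A1: "0 \<le> Acoef \<gamma> A B 1" using Acoef[of 0] by (simp add: \<alpha>_def)
  \<comment> \<open>With \<open>\<omega>(z) = z^(n-1)\<close> the first coefficient after \<open>c\<^sub>1\<close> that need not vanish is \<open>c\<^sub>n\<close>, which thus
    receives all of \<open>\<gamma> (A - B)\<close>.\<close>
  have sharp1: "\<exists>f a. f \<in> class_K l \<gamma> A B m \<mu> \<and> has_expansion f a \<and> cmod (a n) = bound1"
  proof -
    obtain f a c where f: "f \<in> class_K l \<gamma> A B m \<mu>" "has_expansion f a" and c: "c 1 = 1"
      and rec: "\<And>k. of_nat (k + N - 1) * c (k + N) = (\<gamma> * of_real (A - B) - of_real B * (of_nat k - 1)) * c k"
      and a: "\<And>j. cmod (a (Suc j)) = cmod (c (Suc j)) / (1 + real j * l)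
        * (pochhammer (\<mu> + 1) m / pochhammer (\<mu> + real (Suc j)) m)"
      using class_K_extremal[OF assms(1,2,4-6,8) N] by metis
    have "of_nat N * c n = \<gamma> * of_real (A - B)" using rec[of 1] c by (simp add: n)
    then have "real N * cmod (c n) = \<alpha> 0" by (metis \<alpha>_def norm_mult norm_of_nat diff_zero mult_zero_left of_nat_0 of_real_0)
    then have "cmod (c n) = \<alpha> 0 / real N" using N by (simp add: field_simps)
    then have "cmod (a n) = bound1"
      using a[of N] unfolding b1 \<beta>_def R_def n by simp
    with f show ?thesis by blast
  qed
  have sharp2: "\<exists>f a. f \<in> class_K l \<gamma> A B m \<mu> \<and> has_expansion f a \<and> cmod (a n) = bound2"
  proof -
    obtain f a c where f: "f \<in> class_K l \<gamma> A B m \<mu>" "has_expansion f a" and c: "c 1 = 1"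
      and rec: "\<And>k. of_nat (k + 1 - 1) * c (k + 1) = (\<gamma> * of_real (A - B) - of_real B * (of_nat k - 1)) * c k"
      and a: "\<And>j. cmod (a (Suc j)) = cmod (c (Suc j)) / (1 + real j * l)
        * (pochhammer (\<mu> + 1) m / pochhammer (\<mu> + real (Suc j)) m)"
      using class_K_extremal[OF assms(1,2,4-6,8) order_refl[of 1]] by metis
    have "cmod (c n) = (\<Prod>i<N. \<alpha> i) / fact N"
      unfolding n \<alpha>_def by (rule extremal_product[OF c rec])
    then have "cmod (a n) = bound2"
      using a[of N] \<open>fact N = real N * fact (N - 1)\<close> unfolding b2 \<beta>_def R_def n by simp
    with f show ?thesis by blast
  qed
  show ?thesis
  proof (intro conjI allI impI ballI)
    fix f a assume f: "f \<in> class_K l \<gamma> A B m \<mu> \<and> has_expansion f a"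
    show "cmod (a n) \<le> bound1" if "Acoef \<gamma> A B 2 \<le> 0"
      unfolding b1 using f N A1 that by (intro upper) (auto simp: numeral_2_eq_2)
    show "cmod (a n) \<le> bound2" if "0 \<le> Acoef \<gamma> A B (n - 1)"
      unfolding b2 using f N that by (intro upper) (auto simp: n)
    show "cmod (a n) \<le> bound3 k"
      if "k \<in> {2..n-2}" "0 \<le> Acoef \<gamma> A B k \<and> Acoef \<gamma> A B (k + 1) \<le> 0" for k
    proof -
      have "1 \<le> k" using that by simp
      moreover have "cmod (a n) \<le> \<beta> k"
        using f that by (intro upper) (auto simp: n)
      ultimately show ?thesis by (simp only: b3)
    qed
  qed (rule sharp1 sharp2)+
qed

end
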